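(* Let $X$ be a finite set with $N$ elements, let $\tau\in\mathcal{M}_{\geq 1}(X)$ be a multiset of size $L=\|\tau\|\geq N$, and let $\omega\in\mathcal{D}(X)$ be a distribution with full support. Then $$\mathrm{supp}\Big(\mathrm{MN}(\omega)^{L-N+1}(\tau)\Big)\subseteq X,\qquad\text{and then}\qquad \mathrm{MN}(\omega)^{L-N+1}(\tau)=\mathrm{mnff}(\omega,\tau).$$ In particular, $\mathrm{mnff}(\omega,\tau)$ is a probability distribution on $X$, that is, $\sum_{x\in X}\mathrm{mnff}(\omega,\tau)(x)=1$.
   Context: Multisets. A multiset over $X$ is a function $\varphi\colon X\to\mathbb{N}$ with finite support; $\mathcal{M}(X)$ is the set of multisets over $X$; $\|\varphi\|=\sum_x\varphi(x)$; $\mathcal{M}[K](X)=\{\varphi\in\mathcal{M}(X)\mid\|\varphi\|=K\}$. Multisets are added, subtracted and ordered ($\leq$) pointwise; $1|x\rangle$ is the multiset with value $1$ at $x$ and $0$ elsewhere; $\mathbf{1}=\sum_{x\in X}1|x\rangle$. $\mathcal{M}_{\geq1}(X)=\{\tau\in\mathcal{M}(X)\mid\tau\geq\mathbf{1}\}$. Write $\varphi\prec\tau$ ("fully below") if $\varphi(x)<\tau(x)$ for all $x\in X$. Distributions. $\mathcal{D}(A)$ is the set of functions $\omega\colon A\to[0,1]$ with finite support $\mathrm{supp}(\omega)=\{a\mid\omega(a)>0\}$ and $\sum_a\omega(a)=1$, also written as formal convex sums $\sum_i r_i|a_i\rangle$. Full support means $\omega(x)>0$ for all $x\in X$. Multinomial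 distribution. For $\omega\in\mathcal{D}(X)$ and $\varphi\in\mathcal{M}[K](X)$, $\mathrm{mn}[K](\omega)(\varphi)=\frac{K!}{\prod_x\varphi(x)!}\prod_{x\in X}\omega(x)^{\varphi(x)}$. When $[K]$ is omitted, $K=\|\varphi\|$. Multinomial first-full. For $x\in X$, $$\mathrm{mnff}(\omega,\tau)(x)=\sum_{\varphi\prec\tau,\ \varphi(x)=\tau(x)-1}\mathrm{mn}(\omega)(\varphi)\cdot\omega(x).$$ Markov models with output. For a function $c\colon Y\to\mathcal{D}(Y+X)$, with $Y+X$ the disjoint union, the iterates $c^n\colon Y\to\mathcal{D}(Y+X)$, $n\in\mathbb{N}$, are given by $c^0(y)=1|y\rangle$ and $$c^{n+1}(y)=\sum_{z\in Y+X}\Big(\sum_{y'\in Y}c(y)(y')\cdot c^n(y')(z)\Big)|z\rangle+\sum_{x\in X}c(y)(x)|x\rangle.$$ The multinomial model $\mathrm{MN}(\omega)\colon\mathcal{M}_{\geq1}(X)\to\mathcal{D}(\mathcal{M}_{\geq1}(X)+X)$ is $$\mathrm{MN}(\omega)(\tau)=\sum_{x,\,\tau(x)>1}\omega(x)\,\big|\tau-1|x\rangle\big\rangle+\sum_{x,\,\tau(x)=1}\omega(x)\,|x\rangle.$$ A distribution on $\mathcal{M}_{\geq1}(X)+X$ whose support is contained in the summand $X$ is identified with a distribution on $X$. *)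

theory Defs
  imports "HOL-Probability.Probability" "HOL-Library.Multiset"
begin

text \<open>
  The finite set \<open>X\<close> is the type \<open>'a :: finite\<close>. Distributions are \<open>pmf\<close>s, which allow countable
  support; on \<open>'a\<close> there is no difference, and the models used here stay within finite support
  (\<open>finite_set_pmf_MN\<close>, \<open>finite_set_pmf_out_iter\<close>).
\<close>

definition msets_ge1 :: "'a::finite multiset set" where
  "msets_ge1 = {\<tau>. mset_set UNIV \<subseteq># \<tau>}"

lemma msets_ge1_iff: "\<tau> \<in> msets_ge1 \<longleftrightarrow> (\<forall>x. 1 \<le> count \<tau> x)"
  by (simp add: msets_ge1_def subseteq_mset_def)

definition fully_below :: "'a multiset \<Rightarrow> 'a multiset \<Rightarrow> bool" (infix \<open>\<prec>\<close> 50) where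
  "\<phi> \<prec> \<tau> \<longleftrightarrow> (\<forall>x. count \<phi> x < count \<tau> x)"

definition mn :: "'a::finite pmf \<Rightarrow> 'a multiset \<Rightarrow> real" where
  "mn \<omega> \<phi> = fact (size \<phi>) / (\<Prod>x\<in>UNIV. fact (count \<phi> x)) * (\<Prod>x\<in>UNIV. pmf \<omega> x ^ count \<phi> x)"

definition mnff :: "'a::finite pmf \<Rightarrow> 'a multiset \<Rightarrow> 'a \<Rightarrow> real" where
  "mnff \<omega> \<tau> x = (\<Sum>\<phi> | \<phi> \<prec> \<tau> \<and> count \<phi> x = count \<tau> x - 1. mn \<omega> \<phi> * pmf \<omega> x)"

text \<open>The sum in \<open>mnff\<close> is over a finite set, so it is not the default value of \<open>sum\<close>.\<close>

lemma finite_fully_below: "finite {\<phi> :: 'a::finite multiset. \<phi> \<prec> \<tau>}"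
proof (rule finite_imageD)
  show "inj_on count {\<phi>. \<phi> \<prec> \<tau>}"
    by (simp add: inj_on_def multiset_eq_iff)
  have "count ` {\<phi>. \<phi> \<prec> \<tau>} \<subseteq> Pi\<^sub>E UNIV (\<lambda>x. {..<count \<tau> x})"
    by (auto simp: fully_below_def)
  then show "finite (count ` {\<phi>. \<phi> \<prec> \<tau>})"
    by (rule finite_subset) (auto intro: finite_PiE)
qed

primrec out_iter :: "('y \<Rightarrow> ('y + 'x) pmf) \<Rightarrow> nat \<Rightarrow> 'y \<Rightarrow> ('y + 'x) pmf" where
  "out_iter c 0 = (\<lambda>y. return_pmf (Inl y))"
| "out_iter c (Suc n) = (\<lambda>y. bind_pmf (c y) (case_sum (out_iter c n) (\<lambda>x. return_pmf (Inr x))))"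

text \<open>The monadic definition above agrees with the recursion formula on probability masses.\<close>

lemma pmf_out_iter_Suc:
  fixes c :: "'y \<Rightarrow> ('y + 'x) pmf"
  assumes "finite (set_pmf (c y))"
  shows "pmf (out_iter c (Suc n) y) z =
    (\<Sum>y' | Inl y' \<in> set_pmf (c y). pmf (c y) (Inl y') * pmf (out_iter c n y') z) +
    (case z of Inl _ \<Rightarrow> 0 | Inr x \<Rightarrow> pmf (c y) (Inr x))"
proof -
  let ?A = "{y'. Inl y' \<in> set_pmf (c y)}" and ?B = "{x. Inr x \<in> set_pmf (c y)}"
  let ?k = "case_sum (out_iter c n) (\<lambda>x. return_pmf (Inr x))"
  have S: "set_pmf (c y) = Inl ` ?A \<union> Inr ` ?B"
  proof (rule set_eqI)
    fix s show "s \<in> set_pmf (c y) \<longleftrightarrow> s \<in> Inl ` ?A \<union> Inr ` ?B"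
      by (cases s) auto
  qed
  have "finite (Inl ` ?A \<union> Inr ` ?B :: ('y + 'x) set)"
    using assms S by metis
  then have fin: "finite ?A" "finite ?B"
    by (auto simp: finite_image_iff inj_on_def)
  have "pmf (out_iter c (Suc n) y) z = (\<Sum>s\<in>set_pmf (c y). pmf (c y) s * pmf (?k s) z)"
    using assms by (simp add: pmf_bind integral_measure_pmf_real[of "set_pmf (c y)"] mult.commute)
  also have "\<dots> = (\<Sum>s\<in>Inl ` ?A. pmf (c y) s * pmf (?k s) z) + (\<Sum>s\<in>Inr ` ?B. pmf (c y) s * pmf (?k s) z)"
    by (subst S, rule sum.union_disjoint) (use fin in auto)
  also have "(\<Sum>s\<in>Inl ` ?A. pmf (c y) s * pmf (?k s) z) =
      (\<Sum>y'\<in>?A. pmf (c y) (Inl y') * pmf (out_iter c n y') z)"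
    by (subst sum.reindex) (auto simp: inj_on_def)
  also have "(\<Sum>s\<in>Inr ` ?B. pmf (c y) s * pmf (?k s) z) =
      (\<Sum>x\<in>?B. if z = Inr x then pmf (c y) (Inr x) else 0)"
    by (subst sum.reindex) (auto simp: inj_on_def pmf_return indicator_def intro!: sum.cong)
  also have "\<dots> = (case z of Inl _ \<Rightarrow> 0 | Inr x \<Rightarrow> pmf (c y) (Inr x))"
    using fin by (cases z) (auto simp: set_pmf_iff)
  finally show ?thesis .
qed

lemma finite_set_pmf_out_iter:
  assumes "\<And>y. finite (set_pmf (c y))"
  shows "finite (set_pmf (out_iter c n y))"
proof (induction n arbitrary: y)
  case (Suc n)
  then show ?case using assms by (auto split: sum.split)
qed simp

text \<open>
  \<open>MN\<close> is defined on all multisets, but only its restriction to \<open>msets_ge1\<close> is meaningful. That set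
  is closed under transitions (\<open>MN_msets_ge1\<close>), so iterates starting in it never leave it.
\<close>

definition MN :: "'a::finite pmf \<Rightarrow> 'a multiset \<Rightarrow> ('a multiset + 'a) pmf" where
  "MN \<omega> \<tau> = map_pmf (\<lambda>x. if count \<tau> x > 1 then Inl (\<tau> - {#x#}) else Inr x) \<omega>"

lemma finite_set_pmf_MN: "finite (set_pmf (MN \<omega> \<tau>))"
  by (simp add: MN_def)

lemma MN_msets_ge1:
  assumes "\<tau> \<in> msets_ge1" "Inl \<sigma> \<in> set_pmf (MN \<omega> \<tau>)"
  shows "\<sigma> \<in> msets_ge1"
proof -
  obtain x where x: "count \<tau> x > 1" "\<sigma> = \<tau> - {#x#}"
    using assms(2) by (auto simp: MN_def split: if_splits)
  have "1 \<le> count \<sigma> y" for y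
    using assms(1) x by (cases "y = x") (simp_all add: msets_ge1_iff)
  then show ?thesis by (simp add: msets_ge1_iff)
qed

lemma pmf_MN_Inl:
  "pmf (MN \<omega> \<tau>) (Inl \<sigma>) = (\<Sum>x | count \<tau> x > 1 \<and> \<tau> - {#x#} = \<sigma>. pmf \<omega> x)"
proof -
  have "(\<lambda>x. if count \<tau> x > 1 then Inl (\<tau> - {#x#}) else Inr x) -` {Inl \<sigma>} =
      {x. count \<tau> x > 1 \<and> \<tau> - {#x#} = \<sigma>}"
    by (auto split: if_splits)
  then show ?thesis
    by (simp add: MN_def pmf_map measure_measure_pmf_finite)
qed

lemma pmf_MN_Inr:
  assumes "\<tau> \<in> msets_ge1"
  shows "pmf (MN \<omega> \<tau>) (Inr x) = (if count \<tau> x = 1 then pmf \<omega> x else 0)"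
proof -
  have "count \<tau> x = 1 \<longleftrightarrow> \<not> count \<tau> x > 1"
    using assms[unfolded msets_ge1_iff, rule_format, of x] by linarith
  then have "(\<lambda>x. if count \<tau> x > 1 then Inl (\<tau> - {#x#}) else Inr x) -` {Inr x} =
      (if count \<tau> x = 1 then {x} else {})"
    by (auto simp: vimage_def split: if_splits)
  then show ?thesis
    by (simp add: MN_def pmf_map measure_measure_pmf_finite)
qed

end

(* First-step analysis. Conditioning on the first draw gives the multinomial recursion
   mn \<phi> = \<Sum>y. \<omega> y * mn (\<phi> - 1|y>), and summing it over the \<phi> fully below \<tau> shows that mnff satisfies
   the recursion that defines the iterates of MN. Each step that stays in the multisets lowers the
   size by one, and no multiset above 1 has fewer than N elements, so all mass has reached the
   outputs after L - N + 1 steps. *)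

theory Submission
  imports Defs
begin

text \<open>Passing from \<open>\<psi>\<close> to \<open>add_mset y \<psi>\<close> changes only the
  factors at \<open>y\<close> and the leading factorial. The identity is multiplied out to avoid
  quotients.\<close>

lemma mn_add_mset:
  "mn \<omega> (add_mset y \<psi>) * real (count \<psi> y + 1) = real (size \<psi> + 1) * (pmf \<omega> y * mn \<omega> \<psi>)"
proof -
  \<comment> \<open>\<open>g\<close> stands for \<open>fact\<close> or for the powers of
    \<open>pmf \<omega> x\<close>, so one splitting at \<open>y\<close> serves both products in
    \<open>mn\<close>.\<close>
  have rest: "(\<Prod>x\<in>UNIV - {y}. g x (count (add_mset y \<psi>) x)) = (\<Prod>x\<in>UNIV - {y}. g x (count \<psi> x))"
    for g :: "'a \<Rightarrow> nat \<Rightarrow> real"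
    by (rule prod.cong) auto
  have split: "(\<Prod>x\<in>UNIV. g x (count (add_mset y \<psi>) x)) =
      g y (Suc (count \<psi> y)) * (\<Prod>x\<in>UNIV - {y}. g x (count \<psi> x))"
    "(\<Prod>x\<in>UNIV. g x (count \<psi> x)) = g y (count \<psi> y) * (\<Prod>x\<in>UNIV - {y}. g x (count \<psi> x))"
    for g :: "'a \<Rightarrow> nat \<Rightarrow> real"
    using prod.remove[of UNIV y "\<lambda>x. g x (count (add_mset y \<psi>) x)"]
      prod.remove[of UNIV y "\<lambda>x. g x (count \<psi> x)"] rest[of g]
    by simp_all
  define Q :: real where "Q = (\<Prod>x\<in>UNIV - {y}. fact (count \<psi> x))"
  have "Q \<noteq> 0" by (simp add: Q_def)
  then show ?thesis
    unfolding mn_def split(1)[of "\<lambda>_. fact"] split(2)[of "\<lambda>_. fact"]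
      split(1)[of "\<lambda>x. (^) (pmf \<omega> x)"] split(2)[of "\<lambda>x. (^) (pmf \<omega> x)"] Q_def[symmetric]
    by (simp add: divide_simps)
qed

text \<open>The factor \<open>count \<phi> y / size \<phi>\<close> is the share of the orderings of
  \<open>\<phi>\<close> that start with \<open>y\<close>.\<close>

lemma mn_remove:
  assumes "y \<in># \<phi>"
  shows "pmf \<omega> y * mn \<omega> (\<phi> - {#y#}) = mn \<omega> \<phi> * count \<phi> y / size \<phi>"
proof -
  obtain \<psi> where \<phi>: "\<phi> = add_mset y \<psi>"
    using assms by (meson mset_add)
  have "mn \<omega> \<phi> * count \<phi> y = size \<phi> * (pmf \<omega> y * mn \<omega> (\<phi> - {#y#}))"
    using mn_add_mset[of \<omega> y \<psi>] by (simp add: \<phi>)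
  moreover have "real (size \<phi>) \<noteq> 0" by (simp add: \<phi>)
  ultimately show ?thesis by simp
qed

text \<open>The shares from \<open>mn_remove\<close> add up to one. The empty multiset has no first
  draw: there \<open>mn\<close> is 1 and the sum is 0.\<close>

lemma mn_recursion:
  assumes "\<phi> \<noteq> {#}"
  shows "mn \<omega> \<phi> = (\<Sum>y\<in>set_mset \<phi>. pmf \<omega> y * mn \<omega> (\<phi> - {#y#}))"
proof -
  have "(\<Sum>y\<in>set_mset \<phi>. pmf \<omega> y * mn \<omega> (\<phi> - {#y#})) = mn \<omega> \<phi> * real (\<Sum>y\<in>set_mset \<phi>. count \<phi> y) / size \<phi>"
    by (simp add: mn_remove sum_distrib_left sum_divide_distrib)
  also have "\<dots> = mn \<omega> \<phi>"
    using assms by (simp flip: size_multiset_overloaded_eq)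
  finally show ?thesis ..
qed

lemma fully_below_add_mset_iff:
  assumes "count \<tau> y > 1"
  shows "add_mset y \<psi> \<prec> \<tau> \<longleftrightarrow> \<psi> \<prec> \<tau> - {#y#}"
proof -
  have "count (add_mset y \<psi>) z < count \<tau> z \<longleftrightarrow> count \<psi> z < count (\<tau> - {#y#}) z" for z
    using assms by (cases "z = y") auto
  then show ?thesis by (simp add: fully_below_def)
qed

text \<open>Adding \<open>y\<close> is a bijection from the summands for \<open>\<tau> - {#y#}\<close> to the summands for \<open>\<tau>\<close> that contain \<open>y\<close>.\<close>

lemma sum_first_full_step:
  assumes "\<tau> \<in> msets_ge1"
  shows "(\<Sum>\<phi> | \<phi> \<prec> \<tau> \<and> count \<phi> x = count \<tau> x - 1. mn \<omega> \<phi>) =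
    (\<Sum>y | count \<tau> y > 1. pmf \<omega> y *
      (\<Sum>\<psi> | \<psi> \<prec> \<tau> - {#y#} \<and> count \<psi> x = count (\<tau> - {#y#}) x - 1. mn \<omega> \<psi>)) +
    (if count \<tau> x = 1 then 1 else 0)"
proof -
  define F where "F \<sigma> = {\<phi>. \<phi> \<prec> \<sigma> \<and> count \<phi> x = count \<sigma> x - 1}" for \<sigma> :: "'a multiset"
  have fin: "finite (F \<sigma>)" for \<sigma>
    unfolding F_def by (rule finite_subset[OF _ finite_fully_below[of \<sigma>]]) auto
  \<comment> \<open>The one summand that \<open>mn_recursion\<close> does not reach; it accounts for
    the final \<open>if\<close> term.\<close>
  have empty: "{#} \<in> F \<tau> \<longleftrightarrow> count \<tau> x = 1"
  proof -
    have ge1: "1 \<le> count \<tau> z" for z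
      using assms by (simp add: msets_ge1_iff)
    then have "{#} \<prec> \<tau>"
      by (auto simp: fully_below_def Suc_le_lessD)
    \<comment> \<open>Truncated subtraction would also allow \<open>count \<tau> x = 0\<close>,
      which \<open>ge1\<close> excludes.\<close>
    moreover have "0 = count \<tau> x - 1 \<longleftrightarrow> count \<tau> x = 1"
      using ge1[of x] by linarith
    ultimately show ?thesis by (simp only: F_def mem_Collect_eq count_empty simp_thms)
  qed
  \<comment> \<open>This makes the range of \<open>y\<close> independent of \<open>\<phi>\<close>,
    so that the two sums can be exchanged.\<close>
  have big: "count \<tau> y > 1" if "\<phi> \<in> F \<tau>" "y \<in># \<phi>" for \<phi> y
  proof -
    have "count \<phi> y < count \<tau> y" "0 < count \<phi> y"
      using that by (auto simp: F_def fully_below_def)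
    then show ?thesis by linarith
  qed
  have fibre: "(\<Sum>\<phi> | \<phi> \<in> F \<tau> \<and> y \<in># \<phi>. pmf \<omega> y * mn \<omega> (\<phi> - {#y#})) =
      pmf \<omega> y * (\<Sum>\<psi>\<in>F (\<tau> - {#y#}). mn \<omega> \<psi>)" if y: "count \<tau> y > 1" for y
  proof -
    \<comment> \<open>For \<open>y = x\<close> both sides of the count condition drop by one,
      without truncation because \<open>count \<tau> y > 1\<close>.\<close>
    have F_add: "add_mset y \<psi> \<in> F \<tau> \<longleftrightarrow> \<psi> \<in> F (\<tau> - {#y#})" for \<psi>
      using y unfolding F_def by (auto simp: fully_below_add_mset_iff)
    have "(\<Sum>\<phi> | \<phi> \<in> F \<tau> \<and> y \<in># \<phi>. pmf \<omega> y * mn \<omega> (\<phi> - {#y#})) =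
        (\<Sum>\<psi>\<in>F (\<tau> - {#y#}). pmf \<omega> y * mn \<omega> \<psi>)"
      by (rule sum.reindex_bij_witness[of _ "add_mset y" "\<lambda>\<phi>. \<phi> - {#y#}"])
        (auto simp: F_add simp flip: F_add)
    then show ?thesis by (simp add: sum_distrib_left)
  qed
  \<comment> \<open>\<open>mn_recursion\<close> padded with zeros to the common index set; the first
    \<open>if\<close> supplies the value 1 at the empty multiset.\<close>
  have mn: "mn \<omega> \<phi> = (if \<phi> = {#} then 1 else 0) +
      (\<Sum>y | count \<tau> y > 1. if y \<in># \<phi> then pmf \<omega> y * mn \<omega> (\<phi> - {#y#}) else 0)"
    if "\<phi> \<in> F \<tau>" for \<phi>
  proof (cases "\<phi> = {#}")
    case True
    then show ?thesis by (simp add: mn_def)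
  next
    case False
    have "(\<Sum>y | count \<tau> y > 1. if y \<in># \<phi> then pmf \<omega> y * mn \<omega> (\<phi> - {#y#}) else 0) =
        (\<Sum>y\<in>set_mset \<phi>. pmf \<omega> y * mn \<omega> (\<phi> - {#y#}))"
      using big[OF that] by (intro sum.mono_neutral_cong_right) auto
    with False show ?thesis by (simp add: mn_recursion[OF False])
  qed
  have "(\<Sum>\<phi>\<in>F \<tau>. mn \<omega> \<phi>) = (\<Sum>\<phi>\<in>F \<tau>. if \<phi> = {#} then 1 else 0) +
      (\<Sum>\<phi>\<in>F \<tau>. \<Sum>y | count \<tau> y > 1. if y \<in># \<phi> then pmf \<omega> y * mn \<omega> (\<phi> - {#y#}) else 0)"
    by (simp only: mn sum.distrib cong: sum.cong)
  also have "(\<Sum>\<phi>\<in>F \<tau>. if \<phi> = {#} then 1 else 0) = (if count \<tau> x = 1 then 1 else 0 :: real)"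
    using fin by (simp add: empty)
  also have "(\<Sum>\<phi>\<in>F \<tau>. \<Sum>y | count \<tau> y > 1. if y \<in># \<phi> then pmf \<omega> y * mn \<omega> (\<phi> - {#y#}) else 0) =
      (\<Sum>y | count \<tau> y > 1. pmf \<omega> y * (\<Sum>\<psi>\<in>F (\<tau> - {#y#}). mn \<omega> \<psi>))"
    \<comment> \<open>After the exchange, the inner sum keeps only the \<open>\<phi>\<close>
      containing \<open>y\<close>, which is the sum evaluated in \<open>fibre\<close>.\<close>
    by (subst sum.swap, rule sum.cong) (auto simp: fin sum.If_cases Int_def fibre)
  finally show ?thesis by (simp add: F_def)
qed

lemma mnff_eq: "mnff \<omega> \<tau> x = pmf \<omega> x * (\<Sum>\<phi> | \<phi> \<prec> \<tau> \<and> count \<phi> x = count \<tau> x - 1. mn \<omega> \<phi>)"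
  by (simp add: mnff_def sum_distrib_left mult.commute)

text \<open>The factor \<open>pmf \<omega> x\<close> belongs to the last draw, which completes
  \<open>x\<close>, while the first-step recursion acts on the draws before it. The empty history
  thus becomes an immediate output of \<open>x\<close>.\<close>

lemma mnff_step:
  assumes "\<tau> \<in> msets_ge1"
  shows "mnff \<omega> \<tau> x = (\<Sum>y | count \<tau> y > 1. pmf \<omega> y * mnff \<omega> (\<tau> - {#y#}) x) +
    (if count \<tau> x = 1 then pmf \<omega> x else 0)"
  unfolding mnff_eq sum_first_full_step[OF assms] distrib_left
  by (simp add: sum_distrib_left[of "pmf \<omega> x" _ "{y. Suc 0 < count \<tau> y}"] mult.left_commute)

lemma mnff_nonneg: "0 \<le> mnff \<omega> \<tau> x"
  by (auto simp: mnff_def mn_def intro!: sum_nonneg mult_nonneg_nonneg divide_nonneg_nonneg prod_nonneg)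

text \<open>Binding over \<open>\<omega>\<close> indexes the transitions by the drawn element,
  matching the sum in \<open>mnff_step\<close>.\<close>

lemma out_iter_MN_Suc:
  "out_iter (MN \<omega>) (Suc n) \<tau> =
    bind_pmf \<omega> (\<lambda>y. if count \<tau> y > 1 then out_iter (MN \<omega>) n (\<tau> - {#y#}) else return_pmf (Inr y))"
  by (auto simp: MN_def bind_map_pmf intro!: bind_pmf_cong)

lemma size_ge_card:
  fixes \<tau> :: "'a::finite multiset"
  assumes "\<tau> \<in> msets_ge1"
  shows "CARD('a) \<le> size \<tau>"
  using assms size_mset_mono[of "mset_set UNIV" \<tau>] by (simp add: msets_ge1_def)

lemma msets_ge1_remove:
  assumes "\<tau> \<in> msets_ge1" "count \<tau> y > 1"
  shows "\<tau> - {#y#} \<in> msets_ge1"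
  using assms by (auto simp: msets_ge1_iff)

text \<open>Induction on \<open>n\<close>: a draw that does not stop lowers both
  \<open>size \<tau>\<close> and \<open>n\<close> by one, so the size bound is preserved.\<close>

lemma out_iter_MN_eq_mnff:
  fixes \<tau> :: "'a::finite multiset"
  assumes "\<tau> \<in> msets_ge1" "size \<tau> < CARD('a) + n"
  shows "set_pmf (out_iter (MN \<omega>) n \<tau>) \<subseteq> range Inr"
    and "pmf (out_iter (MN \<omega>) n \<tau>) (Inr x) = mnff \<omega> \<tau> x"
proof -
  have "set_pmf (out_iter (MN \<omega>) n \<tau>) \<subseteq> range Inr \<and>
      pmf (out_iter (MN \<omega>) n \<tau>) (Inr x) = mnff \<omega> \<tau> x"
    using assms
  proof (induction n arbitrary: \<tau>)
    case 0
    \<comment> \<open>With no steps left the bound contradicts \<open>size_ge_card\<close>, so this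
      case is vacuous.\<close>
    then show ?case using size_ge_card[of \<tau>] by simp
  next
    case (Suc n)
    have IH: "set_pmf (out_iter (MN \<omega>) n (\<tau> - {#y#})) \<subseteq> range Inr"
      "pmf (out_iter (MN \<omega>) n (\<tau> - {#y#})) (Inr x) = mnff \<omega> (\<tau> - {#y#}) x"
      if y: "count \<tau> y > 1" for y
    proof -
      have "y \<in># \<tau>" using y by (simp flip: count_greater_zero_iff)
      then have "size (\<tau> - {#y#}) < CARD('a) + n"
        using Suc.prems(2) size_Suc_Diff1[of y \<tau>] by simp
      with Suc.IH msets_ge1_remove[OF Suc.prems(1) y]
      show "set_pmf (out_iter (MN \<omega>) n (\<tau> - {#y#})) \<subseteq> range Inr"
        "pmf (out_iter (MN \<omega>) n (\<tau> - {#y#})) (Inr x) = mnff \<omega> (\<tau> - {#y#}) x" by auto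
    qed
    have one: "\<not> count \<tau> x > 1 \<longleftrightarrow> count \<tau> x = 1"
      using Suc.prems(1)[unfolded msets_ge1_iff, rule_format, of x] by linarith
    have "pmf (out_iter (MN \<omega>) (Suc n) \<tau>) (Inr x) = (\<Sum>y\<in>UNIV. pmf \<omega> y *
        (if count \<tau> y > 1 then mnff \<omega> (\<tau> - {#y#}) x else if y = x then 1 else 0))"
      unfolding out_iter_MN_Suc pmf_bind
      by (subst integral_measure_pmf_real[of UNIV])
        (auto simp: IH(2) mult.commute intro!: sum.cong)
    \<comment> \<open>Split into continuing and stopping draws; among the latter only
      \<open>y = x\<close> contributes, and only if \<open>x\<close> itself stops.\<close>
    also have "\<dots> = (\<Sum>y | count \<tau> y > 1. pmf \<omega> y * mnff \<omega> (\<tau> - {#y#}) x) +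
        (\<Sum>y | \<not> count \<tau> y > 1. pmf \<omega> y * (if y = x then 1 else 0))"
      by (simp add: if_distrib[of "(*) _"] sum.If_cases Collect_neg_eq cong: if_cong)
    also have "(\<Sum>y | \<not> count \<tau> y > 1. pmf \<omega> y * (if y = x then 1 else 0)) =
        (if count \<tau> x = 1 then pmf \<omega> x else 0)"
      using one by (simp add: if_distrib[of "(*) _"] cong: if_cong)
    finally have "pmf (out_iter (MN \<omega>) (Suc n) \<tau>) (Inr x) = mnff \<omega> \<tau> x"
      by (simp add: mnff_step[OF Suc.prems(1)])
    moreover have "set_pmf (out_iter (MN \<omega>) (Suc n) \<tau>) \<subseteq> range Inr"
      unfolding out_iter_MN_Suc set_bind_pmf using IH(1) by (intro UN_least) auto
    ultimately show ?case by blast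
  qed
  then show "set_pmf (out_iter (MN \<omega>) n \<tau>) \<subseteq> range Inr"
    and "pmf (out_iter (MN \<omega>) n \<tau>) (Inr x) = mnff \<omega> \<tau> x" by auto
qed

theorem theorem7:
  fixes \<omega> :: "'a::finite pmf" and \<tau> :: "'a multiset" and N L :: nat
  assumes "CARD('a) = N"
    and "\<tau> \<in> msets_ge1"
    and "L = size \<tau>"
    and "L \<ge> N"
    and "set_pmf \<omega> = UNIV"
  shows "set_pmf (out_iter (MN \<omega>) (L - N + 1) \<tau>) \<subseteq> range Inr
      \<and> (\<forall>x. pmf (out_iter (MN \<omega>) (L - N + 1) \<tau>) (Inr x) = mnff \<omega> \<tau> x)
      \<and> (\<forall>x. 0 \<le> mnff \<omega> \<tau> x)
      \<and> (\<Sum>x\<in>UNIV. mnff \<omega> \<tau> x) = 1"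
proof -
  let ?p = "out_iter (MN \<omega>) (L - N + 1) \<tau>"
  \<comment> \<open>\<open>L - N + 1\<close> is the least number of steps that meets this
    bound.\<close>
  have "size \<tau> < CARD('a) + (L - N + 1)"
    using assms by simp
  note iter = out_iter_MN_eq_mnff[OF assms(2) this, of \<omega>]
  have "(\<Sum>x\<in>UNIV. mnff \<omega> \<tau> x) = (\<Sum>x\<in>UNIV. pmf ?p (Inr x))"
    by (simp only: iter(2))
  also have "\<dots> = (\<Sum>z\<in>range Inr. pmf ?p z)"
    by (simp add: sum.reindex)
  \<comment> \<open>The outputs carry the whole support, hence the total mass.\<close>
  also have "\<dots> = 1"
    using iter(1) by (intro sum_pmf_eq_1) auto
  finally show ?thesis
    using iter mnff_nonneg by blast
qed

end
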